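(* Let $\lambda$ be a nonzero real (or complex) number. For every integer $n\ge 0$, $$\beta_{n,\lambda}^{(2)}=(-1)^{n}\sum_{m=0}^{n}\binom{n}{m}\beta_{m,\lambda}\frac{\beta_{n-m,\lambda}(1-\lambda)}{n-m+1}=(-1)^{n}\sum_{m=0}^{n}\binom{n}{m}\beta_{n-m,\lambda}\frac{\beta_{m,\lambda}(1-\lambda)}{m+1}.$$
   Context: All generating functions are formal power series. For nonzero $\lambda$ and any $x$, the degenerate exponential is $e_\lambda^x(t)=(1+\lambda t)^{x/\lambda}=\sum_{n\ge0}\binom{x/\lambda}{n}\lambda^n t^n$ and $e_\lambda(t)=e_\lambda^1(t)$. Carlitz's degenerate Bernoulli polynomials $\beta_{n,\lambda}(x)$ are defined by $\frac{t}{e_{\lambda}(t)-1}e_{\lambda}^{x}(t)=\sum_{n=0}^{\infty}\beta_{n,\lambda}(x)\frac{t^{n}}{n!}$, and $\beta_{n,\lambda}=\beta_{n,\lambda}(0)$. Here $\beta_{n,\lambda}(1-\lambda)$ denotes the value of this polynomial at $x=1-\lambda$. For nonzero $\mu$, put $(1)_{0,\mu}=1$ and $(1)_{n,\mu}=(1-\mu)(1-2\mu)\cdots(1-(n-1)\mu)$ for $n\ge1$ (so $(1)_{1,\mu}=1$). For $k\in\mathbb{Z}$ the degenerate polylogarithm function is $l_{k,\lambda}(x)=\sum_{n=1}^{\infty}\frac{(-\lambda)^{n-1}(1)_{n,1/\lambda}}{(n-1)!\,n^{k}}x^{n}$, and the degenerate poly-Bernoulli numbers $\beta_{n,\lambda}^{(k)}$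 are defined by $$\frac{l_{k,\lambda}(1-e_{\lambda}(-t))}{1-e_{\lambda}(-t)}=\sum_{n=0}^{\infty}\beta_{n,\lambda}^{(k)}\frac{t^{n}}{n!},$$ i.e. by substituting $x=1-e_\lambda(-t)$ (which has zero constant term) into the power series $l_{k,\lambda}(x)/x$. The theorem concerns $k=2$. *)

theory Defs
  imports "HOL-Computational_Algebra.Computational_Algebra"
begin

text \<open>
  Everything is formal: power series are elements of \<^typ>\<open>'a fps\<close> over a field of
  characteristic zero. The parameter \<open>l\<close> is assumed nonzero wherever it matters.
\<close>

definition deg_exp :: "'a::field_char_0 \<Rightarrow> 'a \<Rightarrow> 'a fps" where
  "deg_exp l x = Abs_fps (\<lambda>n. ((x / l) gchoose n) * l ^ n)"

text \<open>
  Both generating functions below are quotients by a series without constant term, but the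
  denominator divides the numerator, so that the library's division of power series is exact
  (lemmas \<open>deg_bernoulli_gf\<close> and \<open>deg_poly_bernoulli_gf\<close>).
\<close>

definition deg_bernoulli :: "'a::field_char_0 \<Rightarrow> nat \<Rightarrow> 'a \<Rightarrow> 'a" where
  "deg_bernoulli l n x =
     fact n * fps_nth (fps_X / (deg_exp l 1 - 1) * deg_exp l x) n"

abbreviation deg_bernoulli_num :: "'a::field_char_0 \<Rightarrow> nat \<Rightarrow> 'a" where
  "deg_bernoulli_num l n \<equiv> deg_bernoulli l n 0"

definition deg_one :: "nat \<Rightarrow> 'a::field_char_0 \<Rightarrow> 'a" where
  "deg_one n m = (\<Prod>i=1..<n. 1 - of_nat i * m)"

definition deg_polylog :: "int \<Rightarrow> 'a::field_char_0 \<Rightarrow> 'a fps" where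
  "deg_polylog k l = Abs_fps (\<lambda>n. if n = 0 then 0
     else (- l) ^ (n - 1) * deg_one n (1 / l) / (fact (n - 1) * of_nat n powi k))"

definition one_minus_deg_exp_neg :: "'a::field_char_0 \<Rightarrow> 'a fps" where
  "one_minus_deg_exp_neg l = 1 - (deg_exp l 1 oo (- fps_X))"

definition deg_poly_bernoulli :: "int \<Rightarrow> 'a::field_char_0 \<Rightarrow> nat \<Rightarrow> 'a" where
  "deg_poly_bernoulli k l n =
     fact n * fps_nth ((deg_polylog k l oo one_minus_deg_exp_neg l) / one_minus_deg_exp_neg l) n"

lemma deg_exp_minus_one_dvd:
  assumes "l \<noteq> (0::'a::field_char_0)"
  shows "deg_exp l 1 - 1 \<noteq> 0" "deg_exp l 1 - 1 dvd fps_X"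
proof -
  have "fps_nth (deg_exp l 1 - 1) 0 = 0" "fps_nth (deg_exp l 1 - 1) 1 = 1"
    using assms by (simp_all add: deg_exp_def)
  then have sd: "subdegree (deg_exp l 1 - 1) = 1"
    by (intro subdegreeI) auto
  then show "deg_exp l 1 - 1 \<noteq> 0"
    by auto
  then show "deg_exp l 1 - 1 dvd fps_X"
    using sd by (simp add: fps_dvd_iff)
qed

lemma deg_bernoulli_gf:
  assumes "l \<noteq> (0::'a::field_char_0)"
  shows "(deg_exp l 1 - 1) * Abs_fps (\<lambda>n. deg_bernoulli l n x / fact n) = fps_X * deg_exp l x"
proof -
  have "Abs_fps (\<lambda>n. deg_bernoulli l n x / fact n) = fps_X / (deg_exp l 1 - 1) * deg_exp l x"
    by (simp add: fps_eq_iff deg_bernoulli_def)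
  then show ?thesis
    using deg_exp_minus_one_dvd[OF assms] by (simp add: mult.assoc[symmetric])
qed

text \<open>\<^term>\<open>deg_bernoulli l n\<close> is indeed a polynomial function.\<close>

lemma deg_bernoulli_polynomial:
  "\<exists>p. \<forall>x. deg_bernoulli l n x = poly p (x :: 'a::field_char_0)"
proof -
  define c where "c i = fps_nth (fps_X / (deg_exp l 1 - 1)) i" for i
  define q where
    "q m = smult (l ^ m / fact m) (\<Prod>i = 0..<m. [:- of_nat i, 1 / l:])" for m
  have q: "poly (q m) x = fps_nth (deg_exp l x) m" for m x
    by (simp add: q_def deg_exp_def gbinomial_prod_rev poly_prod)
  have "deg_bernoulli l n x = poly (smult (fact n) (\<Sum>i=0..n. smult (c i) (q (n - i)))) x" for x
    by (simp add: deg_bernoulli_def fps_mult_nth poly_sum q c_def)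
  then show ?thesis by blast
qed

text \<open>Substituting into the series \<open>l\<^sub>k(x)/x\<close> gives the same generating function.\<close>

lemma deg_poly_bernoulli_gf:
  assumes "l \<noteq> (0::'a::field_char_0)"
  shows "Abs_fps (\<lambda>n. deg_poly_bernoulli k l n / fact n)
    = (deg_polylog k l / fps_X) oo one_minus_deg_exp_neg l"
proof -
  let ?g = "one_minus_deg_exp_neg l"
  have g0: "fps_nth ?g 0 = 0"
    by (simp add: one_minus_deg_exp_neg_def deg_exp_def)
  have "fps_nth ?g 1 = 1"
    using assms by (simp add: one_minus_deg_exp_neg_def deg_exp_def fps_compose_nth)
  then have gn: "?g \<noteq> 0"
    by auto
  have "deg_polylog k l = (deg_polylog k l / fps_X) * fps_X"
    by (rule fps_ext) (simp add: deg_polylog_def)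
  then have "deg_polylog k l oo ?g = ((deg_polylog k l / fps_X) oo ?g) * ?g"
    using g0 by (metis fps_X_fps_compose_startby0 fps_compose_mult_distrib)
  then have "(deg_polylog k l oo ?g) / ?g = (deg_polylog k l / fps_X) oo ?g"
    using gn by simp
  then show ?thesis
    by (simp add: fps_eq_iff deg_poly_bernoulli_def)
qed

end

theory Submission
  imports Defs
begin

text \<open>
  Replace \<open>t\<close> by \<open>-t\<close> and write \<open>E\<close> for the degenerate exponential \<open>deg_exp l 1\<close>. The first
  polylogarithm is \<open>(1 - (1 - x)\<^sup>l) / l\<close>, so composing it with \<open>1 - E\<close> gives \<open>-t\<close>. Since the
  second one satisfies \<open>x l\<^sub>2'(x) = l\<^sub>1(x)\<close> and \<open>E'\<close> is \<open>deg_exp l (1 - l)\<close>, the series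
  \<open>T = l\<^sub>2(1 - E)\<close> has derivative \<open>- t E' / (E - 1)\<close>, which is minus the generating function of the
  Bernoulli values at \<open>1 - l\<close>. Integrating and dividing by \<open>1 - E\<close> exhibits the generating function
  of the poly-Bernoulli numbers as a product of two explicit series.
\<close>

text \<open>The quotient \<open>Q\<close> of \<open>P\<close> by \<open>U\<close> satisfies
  \<open>U * U * Q' = U * P' - P * U' = 0\<close>, so it is constant, and the constant terms force
  it to be 1.\<close>

lemma fps_eqI_linear_ODE:
  fixes P U :: "'a::field_char_0 fps"
  assumes ode: "U * fps_deriv P = P * fps_deriv U"
    and U0: "fps_nth U 0 \<noteq> 0" and P0: "fps_nth P 0 = fps_nth U 0"
  shows "P = U"
proof -
  define Q where "Q = P * inverse U"
  have iU: "inverse U * U = 1"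
    using U0 by (rule inverse_mult_eq_1)
  have P: "P = Q * U"
    by (simp add: Q_def mult.assoc iU)
  have "U * U * fps_deriv Q = 0"
    using ode by (simp add: P algebra_simps)
  then have "fps_deriv Q = 0"
    using U0 by auto
  then obtain c where c: "Q = fps_const c"
    by (auto simp: fps_deriv_eq_0_iff)
  have "c = 1"
    using P0 U0 by (simp add: P c)
  then show ?thesis
    by (simp add: P c)
qed

lemma deg_exp_nth_0 [simp]: "fps_nth (deg_exp l x) 0 = 1"
  by (simp add: deg_exp_def)

lemma deg_exp_0 [simp]: "deg_exp l 0 = 1"
proof (rule fps_ext)
  fix n show "fps_nth (deg_exp l 0) n = fps_nth 1 n"
    by (cases n) (simp_all add: deg_exp_def)
qed

lemma fps_deriv_deg_exp_1:
  assumes "l \<noteq> 0"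
  shows "fps_deriv (deg_exp l 1) = deg_exp l (1 - l)"
proof (rule fps_ext)
  fix n
  have "fps_nth (fps_deriv (deg_exp l 1)) n
      = of_nat (Suc n) * ((1 / l) gchoose Suc n) * l ^ Suc n"
    by (simp add: deg_exp_def)
  also have "\<dots> = ((1 / l - 1) gchoose n) * l ^ n"
    using assms by (subst gbinomial_absorption) simp
  finally show "fps_nth (fps_deriv (deg_exp l 1)) n = fps_nth (deg_exp l (1 - l)) n"
    using assms by (simp add: deg_exp_def diff_divide_distrib)
qed

text \<open>Formal trace of \<open>E = (1 + l t)^(1/l)\<close>: comparing coefficients, the equation
  is Pascal's rule for the upper argument \<open>1 / l - 1\<close>.\<close>

lemma deg_exp_1_ODE:
  assumes "l \<noteq> 0"
  shows "(1 + fps_const l * fps_X) * fps_deriv (deg_exp l 1) = deg_exp l 1"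
proof (rule fps_ext)
  fix n
  show "fps_nth ((1 + fps_const l * fps_X) * fps_deriv (deg_exp l 1)) n = fps_nth (deg_exp l 1) n"
  proof (cases n)
    case 0
    then show ?thesis using assms by (simp add: fps_deriv_deg_exp_1)
  next
    case (Suc m)
    have "((1 / l - 1) gchoose Suc m) + ((1 / l - 1) gchoose m) = (1 / l) gchoose Suc m"
      using gbinomial_Suc_Suc[of "1 / l - 1" m] by simp
    moreover have "fps_nth ((1 + fps_const l * fps_X) * deg_exp l (1 - l)) (Suc m)
        = (((1 / l - 1) gchoose Suc m) + ((1 / l - 1) gchoose m)) * l ^ Suc m"
      using assms by (simp add: deg_exp_def diff_divide_distrib distrib_right mult.assoc)
    ultimately show ?thesis
      using assms by (simp add: fps_deriv_deg_exp_1 Suc) (simp add: deg_exp_def)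
  qed
qed

text \<open>This gives a meaning to \<open>E^l = 1 + l t\<close> for an exponent \<open>l\<close>
  that need not be an integer: \<open>fps_binomial l\<close> is \<open>(1 + x)^l\<close>, taken at
  \<open>x = E - 1\<close>. Both sides solve \<open>(1 + l t) P' = l P\<close> and have constant
  term 1.\<close>

lemma fps_binomial_compose_deg_exp:
  assumes l: "l \<noteq> 0"
  shows "fps_binomial l oo (deg_exp l 1 - 1) = 1 + fps_const l * fps_X"
proof (rule fps_eqI_linear_ODE)
  let ?E = "deg_exp l 1" and ?U = "1 + fps_const l * fps_X"
  define P where "P = fps_binomial l oo (?E - 1)"
  define D where "D = fps_deriv (fps_binomial l) oo (?E - 1)"
  have "(1 + fps_X) * fps_deriv (fps_binomial l) = fps_const l * fps_binomial l"
    by (simp add: fps_binomial_deriv fps_divide_unit mult.left_commute inverse_mult_eq_1')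
  then have "((1 + fps_X) * fps_deriv (fps_binomial l)) oo (?E - 1) = (fps_const l * fps_binomial l) oo (?E - 1)"
    by simp
  then have ED: "?E * D = fps_const l * P"
    by (simp add: fps_compose_mult_distrib fps_compose_add_distrib D_def P_def)
  \<comment> \<open>The extra factor \<open>E\<close> is the image of \<open>1 + x\<close>, which
    turns the outer derivative \<open>D\<close> into \<open>l P\<close>; it is cancelled at the
    end.\<close>
  have "?E * (?U * fps_deriv P) = ?E * (?U * (D * fps_deriv ?E))"
    by (simp add: P_def D_def fps_compose_deriv)
  also have "\<dots> = (?E * D) * (?U * fps_deriv ?E)"
    by (simp add: algebra_simps)
  also have "\<dots> = ?E * (P * fps_const l)"
    by (simp only: deg_exp_1_ODE[OF l] ED) (simp only: mult_ac)
  finally have "?E * (?U * fps_deriv P) = ?E * (P * fps_const l)" .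
  moreover have "?E \<noteq> 0"
    using deg_exp_nth_0[of l 1] by (metis fps_zero_nth zero_neq_one)
  ultimately show "?U * fps_deriv (fps_binomial l oo (?E - 1)) = (fps_binomial l oo (?E - 1)) * fps_deriv ?U"
    by (simp add: P_def)
qed simp_all

text \<open>Each of the \<open>n\<close> factors \<open>1 - i / l\<close> absorbs one
  \<open>- l\<close> and becomes \<open>- (l - i)\<close>; what remains is the falling factorial of
  \<open>l - 1\<close>.\<close>

lemma deg_one_gbinomial:
  fixes l :: "'a::field_char_0"
  assumes l: "l \<noteq> 0"
  shows "(- l) ^ n * deg_one (Suc n) (1 / l) = (- 1) ^ n * fact n * ((l - 1) gchoose n)"
proof -
  have "(- l) ^ n * deg_one (Suc n) (1 / l) = (\<Prod>i=1..<Suc n. (- l) * (1 - of_nat i * (1 / l)))"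
    unfolding deg_one_def prod.distrib by (simp del: prod.op_ivl_Suc)
  also have "\<dots> = (\<Prod>i=1..<Suc n. (- 1) * (l - of_nat i))"
    using l by (intro prod.cong) (simp_all add: field_simps)
  also have "\<dots> = (- 1) ^ n * (\<Prod>i=1..<Suc n. l - of_nat i)"
    by (subst prod.distrib) simp
  also have "(\<Prod>i=1..<Suc n. l - of_nat i) = (\<Prod>i=0..<n. l - 1 - of_nat i)"
    by (subst prod.shift_bounds_Suc_ivl[of _ 0, simplified One_nat_def[symmetric]])
      (simp add: algebra_simps)
  also have "\<dots> = fact n * ((l - 1) gchoose n)"
    by (simp add: gbinomial_mult_fact)
  finally show ?thesis by (simp add: mult.assoc)
qed

text \<open>The Euler operator multiplies the \<open>n\<close>-th coefficient by \<open>n\<close>,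
  which cancels one power of \<open>n\<close> in the denominator.\<close>

lemma fps_X_mult_deriv_deg_polylog:
  "fps_X * fps_deriv (deg_polylog k l) = deg_polylog (k - 1) l"
proof (rule fps_ext)
  fix n
  show "fps_nth (fps_X * fps_deriv (deg_polylog k l)) n = fps_nth (deg_polylog (k - 1) l) n"
    by (cases n) (simp_all add: deg_polylog_def power_int_diff del: of_nat_Suc)
qed

text \<open>The composition with \<open>- fps_X\<close> is \<open>(1 - x)^l\<close>; the
  coefficients agree by absorption,
  \<open>l * (l - 1 gchoose m) = (m + 1) * (l gchoose m + 1)\<close>.\<close>

lemma deg_polylog_1:
  assumes "l \<noteq> 0"
  shows "fps_const l * deg_polylog 1 l = 1 - (fps_binomial l oo - fps_X)"
proof (rule fps_ext)
  fix n
  show "fps_nth (fps_const l * deg_polylog 1 l) n = fps_nth (1 - (fps_binomial l oo - fps_X)) n"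
  proof (cases n)
    case (Suc m)
    have "fps_nth (fps_const l * deg_polylog 1 l) n
        = (- 1) ^ m * (l * ((l - 1) gchoose m)) / of_nat (Suc m)"
      using assms by (simp add: Suc deg_polylog_def deg_one_gbinomial del: of_nat_Suc)
    also have "\<dots> = (- 1) ^ m * (l gchoose Suc m)"
      by (subst gbinomial_absorption[symmetric]) (simp del: of_nat_Suc)
    finally show ?thesis
      by (simp add: Suc fps_compose_uminus')
  qed (simp add: deg_polylog_def)
qed

lemma deg_polylog_1_compose:
  assumes l: "l \<noteq> 0"
  shows "deg_polylog 1 l oo (1 - deg_exp l 1) = - fps_X"
proof -
  let ?g = "1 - deg_exp l 1"
  have "fps_const l * (deg_polylog 1 l oo ?g) = (fps_const l * deg_polylog 1 l) oo ?g"
    by (simp add: fps_compose_mult_distrib)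
  also have "\<dots> = 1 - (fps_binomial l oo (- fps_X oo ?g))"
    by (simp add: deg_polylog_1 l fps_compose_sub_distrib fps_compose_assoc)
  also have "- fps_X oo ?g = deg_exp l 1 - 1"
    by (simp add: fps_compose_uminus)
  also have "1 - (fps_binomial l oo (deg_exp l 1 - 1)) = fps_const l * (- fps_X)"
    by (simp add: fps_binomial_compose_deg_exp l)
  finally show ?thesis
    using l by (subst (asm) mult_left_cancel) simp_all
qed

theorem theorem5:
  fixes l :: "'a::real_normed_field" and n :: nat
  assumes "l \<noteq> 0"
  shows "deg_poly_bernoulli 2 l n =
           (-1) ^ n * (\<Sum>m=0..n. of_nat (n choose m) * deg_bernoulli_num l m *
             (deg_bernoulli l (n - m) (1 - l) / of_nat (n - m + 1)))
       \<and> (-1) ^ n * (\<Sum>m=0..n. of_nat (n choose m) * deg_bernoulli_num l m *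
             (deg_bernoulli l (n - m) (1 - l) / of_nat (n - m + 1))) =
         (-1) ^ n * (\<Sum>m=0..n. of_nat (n choose m) * deg_bernoulli_num l (n - m) *
             (deg_bernoulli l m (1 - l) / of_nat (m + 1)))"
proof
  let ?E = "deg_exp l 1"
  define B where "B x = Abs_fps (\<lambda>n. deg_bernoulli l n x / fact n)" for x
  \<comment> \<open>The divisor \<open>n + 1\<close> makes \<open>fps_X * C\<close> the
    antiderivative of \<open>B (1 - l)\<close> without constant term.\<close>
  define C where "C = Abs_fps (\<lambda>n. deg_bernoulli l n (1 - l) / (of_nat (Suc n) * fact n))"
  define M where "M = deg_polylog 2 l / fps_X"
  define H where "H = M oo (1 - ?E)"
  define T where "T = deg_polylog 2 l oo (1 - ?E)"
  note B = deg_bernoulli_gf[OF assms, folded B_def]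
  have E: "?E - 1 \<noteq> 0"
    by (rule deg_exp_minus_one_dvd) fact
  have "deg_polylog 2 l = M * fps_X"
    unfolding M_def by (rule fps_ext) (simp add: deg_polylog_def)
  then have TH: "T = H * (1 - ?E)"
    by (simp add: T_def H_def fps_compose_mult_distrib)
  have "(fps_X * fps_deriv (deg_polylog 2 l)) oo (1 - ?E) = - fps_X"
    by (simp add: fps_X_mult_deriv_deg_polylog deg_polylog_1_compose assms)
  then have "(1 - ?E) * (fps_deriv (deg_polylog 2 l) oo (1 - ?E)) = - fps_X"
    by (simp add: fps_compose_mult_distrib)
  moreover have "fps_deriv T = - ((fps_deriv (deg_polylog 2 l) oo (1 - ?E)) * deg_exp l (1 - l))"
    by (simp add: T_def fps_compose_deriv fps_deriv_deg_exp_1 assms)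
  ultimately have "(?E - 1) * fps_deriv T = - (fps_X * deg_exp l (1 - l))"
    by (metis (no_types, lifting) minus_diff_eq minus_minus minus_mult_commute mult.assoc mult_minus_left)
  also have "\<dots> = (?E - 1) * - B (1 - l)"
    by (simp add: B)
  finally have "fps_deriv T = - B (1 - l)"
    using E by (metis mult_left_cancel)
  moreover have "fps_deriv (- (fps_X * C)) = - B (1 - l)"
    by (rule fps_ext) (simp add: B_def C_def del: of_nat_Suc fps_deriv_mult)
  moreover have "fps_nth T 0 = fps_nth (- (fps_X * C)) 0"
    by (simp add: T_def deg_polylog_def)
  ultimately have T: "T = - (fps_X * C)"
    by (metis fps_deriv_eq_iff fps_const_0_eq_0 add_0 diff_self)
  have "(?E - 1) * H = fps_X * C"
    using TH T by (simp add: algebra_simps)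
  \<comment> \<open>Since \<open>deg_exp l 0 = 1\<close>, the series \<open>B 0\<close> is
    \<open>t / (E - 1)\<close>.\<close>
  also have "\<dots> = (?E - 1) * (B 0 * C)"
    using B[of 0] by (simp flip: mult.assoc)
  finally have H: "H = B 0 * C"
    using E by (metis mult_left_cancel)
  \<comment> \<open>Undoing the change of \<open>t\<close> to \<open>-t\<close> in \<open>H\<close>
    produces the sign \<open>(- 1) ^ n\<close>.\<close>
  have "one_minus_deg_exp_neg l = (1 - ?E) oo - fps_X"
    by (simp add: one_minus_deg_exp_neg_def fps_compose_sub_distrib)
  then have "Abs_fps (\<lambda>n. deg_poly_bernoulli 2 l n / fact n) = H oo - fps_X"
    by (simp add: deg_poly_bernoulli_gf[OF assms] H_def M_def fps_compose_assoc)
  then have "deg_poly_bernoulli 2 l n / fact n = (- 1) ^ n * fps_nth (B 0 * C) n"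
    by (simp add: fps_eq_iff fps_compose_uminus' H)
  then have "deg_poly_bernoulli 2 l n = (- 1) ^ n * (fact n * fps_nth (B 0 * C) n)"
    by (simp add: field_simps)
  also have "fact n * fps_nth (B 0 * C) n = (\<Sum>m=0..n. of_nat (n choose m) * deg_bernoulli_num l m *
             (deg_bernoulli l (n - m) (1 - l) / of_nat (n - m + 1)))"
    unfolding fps_mult_nth sum_distrib_left
    by (intro sum.cong) (simp_all add: B_def C_def binomial_fact divide_simps del: of_nat_Suc)
  finally show "deg_poly_bernoulli 2 l n =
           (-1) ^ n * (\<Sum>m=0..n. of_nat (n choose m) * deg_bernoulli_num l m *
             (deg_bernoulli l (n - m) (1 - l) / of_nat (n - m + 1)))" .
  show "(-1) ^ n * (\<Sum>m=0..n. of_nat (n choose m) * deg_bernoulli_num l m *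
             (deg_bernoulli l (n - m) (1 - l) / of_nat (n - m + 1))) =
         (-1) ^ n * (\<Sum>m=0..n. of_nat (n choose m) * deg_bernoulli_num l (n - m) *
             (deg_bernoulli l m (1 - l) / of_nat (m + 1)))"
    \<comment> \<open>The sum is reversed by \<open>m\<close> to \<open>n - m\<close>, under which
      the binomial coefficient is symmetric.\<close>
    by (subst sum.atLeastAtMost_rev) (simp add: binomial_symmetric[symmetric])
qed

end
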